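(* Let $X \subseteq \mathbb{R}^n$ be an open set and let $\tilde f : X \to F(\mathbb{R})$ be a twice continuously gH-differentiable fuzzy-valued function on $X$. If $\bar x^* \in X$ is a local minimizer of the problem "Minimize $\tilde f(\bar x)$, $\bar x \in X$" (with respect to the linear order relation $\preceq$ on $F(\mathbb{R})$), then $$\int_0^1 \alpha \,\big[\nabla^2(\tilde f_\alpha^L + \tilde f_\alpha^U)(\bar x^* )\big]\, d\alpha$$ is a positive semi-definite matrix, where $\nabla^2$ denotes the ordinary Hessian matrix in $\bar x$ of the real-valued function $\tilde f_\alpha^L+\tilde f_\alpha^U$ and the integral is taken entrywise.
   Context: Fuzzy numbers. A fuzzy number is a function $\tilde a:\mathbb{R}\to[0,1]$ such that: (i) $\tilde a(r_0)=1$ for some $r_0\in\mathbb{R}$; (ii) $\tilde a(tr+(1-t)s)\ge\min\{\tilde a(r),\tilde a(s)\}$ for all $r,s\in\mathbb{R}$, $t\in[0,1]$; (iii) $\tilde a$ is upper semicontinuous; (iv) the closure of $\{r:\tilde a(r)>0\}$ is compact. $F(\mathbb{R})$ is the set of all fuzzy numbers. For $\alpha\in(0,1]$ the $\alpha$-level set is $\tilde a_\alpha=\{r:\tilde a(r)\ge\alpha\}$, and $\tilde a_0$ is the closure of $\{r:\tilde a(r)>0\}$; each is a compact interval written $\tilde a_\alpha=[\tilde a_\alpha^L,\tilde a_\alpha^U]$. A fuzzy number is determined by its level sets. Arithmetic. For $\alpha\in[0,1]$: $(\tilde a\oplus\tilde b)_\alpha=[\tilde a_\alpha^L+\tilde b_\alpha^L,\tilde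 a_\alpha^U+\tilde b_\alpha^U]$; for $\lambda\in\mathbb{R}$, $(\lambda\odot\tilde a)_\alpha=[\lambda\tilde a_\alpha^L,\lambda\tilde a_\alpha^U]$ if $\lambda\ge0$ and $[\lambda\tilde a_\alpha^U,\lambda\tilde a_\alpha^L]$ if $\lambda<0$. Order. $\tilde a\preceq\tilde b$ means $\int_0^1\alpha[\tilde a_\alpha^L+\tilde a_\alpha^U]\,d\alpha\le\int_0^1\alpha[\tilde b_\alpha^L+\tilde b_\alpha^U]\,d\alpha$. Metric. $d_F(\tilde a,\tilde b)=\sup_{0\le\alpha\le1}\max\{|\tilde a_\alpha^L-\tilde b_\alpha^L|,|\tilde a_\alpha^U-\tilde b_\alpha^U|\}$. Limits and continuity of fuzzy-valued functions are with respect to $d_F$. Level functions. For $\tilde f:X\to F(\mathbb{R})$ and $\alpha\in[0,1]$, $\tilde f_\alpha^L(\bar x)=(\tilde f(\bar x))_\alpha^L$ and $\tilde f_\alpha^U(\bar x)=(\tilde f(\bar x))_\alpha^U$. gH-difference. $\tilde a\ominus_{gH}\tilde b$ is the fuzzy number $\tilde c$, if it exists, such that $\tilde a=\tilde b\oplus\tilde c$ or $\tilde b=\tilde a\oplus((-1)\odot\tilde c)$. Its level sets are $[\min\{\tilde a_\alpha^L-\tilde b_\alpha^L,\tilde a_\alpha^U-\tilde b_\alpha^U\},\max\{\tilde a_\alpha^L-\tilde b_\alpha^L,\tilde a_\alpha^U-\tilde b_\alpha^U\}]$. gH-differentiability in one variable. For an open interval $I$, $\tilde g:I\to F(\mathbb{R})$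 is gH-differentiable at $x_0\in I$ with gH-derivative $\tilde g'_{gH}(x_0)\in F(\mathbb{R})$ if $\tilde g'_{gH}(x_0)=\lim_{h\to0}\frac1h\odot\big(\tilde g(x_0+h)\ominus_{gH}\tilde g(x_0)\big)$ exists in $F(\mathbb{R})$. gH-differentiability in several variables. For $X\subseteq\mathbb{R}^n$ open, $\tilde f:X\to F(\mathbb{R})$ has $i$-th partial gH-derivative $D_i\tilde f(\bar x^0)=\frac{\partial\tilde f}{\partial x_i}(\bar x^0)$ at $\bar x^0\in X$ if the function $x_i\mapsto\tilde f(x_1^0,\dots,x_{i-1}^0,x_i,x_{i+1}^0,\dots,x_n^0)$ is gH-differentiable at $x_i^0$ with that gH-derivative. $\tilde f$ is gH-differentiable at $\bar x^0$ if one of the partial gH-derivatives exists at $\bar x^0$ and the remaining $n-1$ exist on some neighborhood of $\bar x^0$ and are continuous at $\bar x^0$. $\tilde f$ is gH-differentiable on $X$ if it is so at every point of $X$; its gradient is then $\nabla\tilde f=(D_1\tilde f,\dots,D_n\tilde f)$. Second order. $\tilde f$ is twice gH-differentiable at $\bar x^0$ if $\nabla\tilde f$ is gH-differentiable at $\bar x^0$, i.e. each $D_i\tilde f:X\to F(\mathbb{R})$ is gH-differentiable at $\bar x^0$; $\frac{\partial^2\tilde f}{\partial x_i\partial x_j}(\bar x^0)\in F(\mathbb{R})$ denotes the partial gH-derivative of $D_i\tilde f$ in the direction of the $j$-th coordinate vector at $\bar x^0$. $\tilde f$ is twice continuously gH-differentiable on $X$ if it is twice gH-differentiable at every point of $X$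 and, for all $i,j=1,\dots,n$, $\frac{\partial^2\tilde f}{\partial x_i\partial x_j}:X\to F(\mathbb{R})$ is continuous. Local minimizer. $\bar x^*\in X$ is a local minimizer if there is $\epsilon>0$ such that $\tilde f(\bar x^* )\preceq\tilde f(\bar x)$ for all $\bar x\in X$ with $\|\bar x-\bar x^*\|<\epsilon$. *)

theory Defs
  imports "HOL-Analysis.Analysis"
begin

section \<open>Fuzzy numbers and their level sets\<close>

definition upper_semicontinuous :: "(real \<Rightarrow> real) \<Rightarrow> bool" where
  "upper_semicontinuous a \<longleftrightarrow> (\<forall>r y. a r < y \<longrightarrow> (\<forall>\<^sub>F s in nhds r. a s < y))"

definition is_fuzzy_number :: "(real \<Rightarrow> real) \<Rightarrow> bool" where
  "is_fuzzy_number a \<longleftrightarrow>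
     (\<forall>r. 0 \<le> a r \<and> a r \<le> 1) \<and>
     (\<exists>r\<^sub>0. a r\<^sub>0 = 1) \<and>
     (\<forall>r s. \<forall>t\<in>{0..1}. min (a r) (a s) \<le> a (t * r + (1 - t) * s)) \<and>
     upper_semicontinuous a \<and>
     compact (closure {r. 0 < a r})"

typedef fuzzy = "{a. is_fuzzy_number a}" morphisms membership Abs_fuzzy
proof
  let ?a = "\<lambda>r::real. if r = 0 then 1 else (0::real)"
  have "upper_semicontinuous ?a"
    unfolding upper_semicontinuous_def
  proof (intro allI impI)
    fix r y :: real assume y: "?a r < y"
    show "\<forall>\<^sub>F s in nhds r. ?a s < y"
    proof (cases "r = 0")
      case True
      with y show ?thesis by (intro always_eventually) auto
    next
      case False
      have "\<forall>\<^sub>F s in nhds r. s \<noteq> 0"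
        using False by (simp add: t1_space_nhds)
      then show ?thesis
        by eventually_elim (use y False in auto)
    qed
  qed
  moreover have "min (?a r) (?a s) \<le> ?a (t * r + (1 - t) * s)" for r s t by auto
  moreover have "{r. 0 < ?a r} = {0}" by auto
  ultimately have "is_fuzzy_number ?a"
    unfolding is_fuzzy_number_def by auto
  then show "?a \<in> {a. is_fuzzy_number a}" by simp
qed

definition level :: "fuzzy \<Rightarrow> real \<Rightarrow> real set" where
  "level a \<alpha> = (if \<alpha> = 0 then closure {r. 0 < membership a r} else {r. \<alpha> \<le> membership a r})"

definition lowr :: "fuzzy \<Rightarrow> real \<Rightarrow> real" where
  "lowr a \<alpha> = Inf (level a \<alpha>)"

definition uppr :: "fuzzy \<Rightarrow> real \<Rightarrow> real" where
  "uppr a \<alpha> = Sup (level a \<alpha>)"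

lemma is_fuzzy_membership: "is_fuzzy_number (membership a)"
  using membership by auto

lemma level_mono:
  assumes "0 \<le> \<alpha>" "\<alpha> \<le> \<beta>" shows "level a \<beta> \<subseteq> level a \<alpha>"
proof -
  have "{r. \<beta> \<le> membership a r} \<subseteq> closure {r. 0 < membership a r}" if "\<beta> > 0"
    by (rule subset_trans[OF _ closure_subset]) (use that in auto)
  then show ?thesis using assms by (auto simp: level_def)
qed

lemma level_interval:
  assumes "\<alpha> \<in> {0..1}"
  shows "level a \<alpha> = {lowr a \<alpha>..uppr a \<alpha>}" and "lowr a \<alpha> \<le> uppr a \<alpha>"
proof -
  let ?a = "membership a"
  have F: "\<And>r. 0 \<le> ?a r \<and> ?a r \<le> 1" "\<exists>r0. ?a r0 = 1"
    "\<And>r s t. t \<in> {0..1} \<Longrightarrow> min (?a r) (?a s) \<le> ?a (t * r + (1 - t) * s)"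
    "upper_semicontinuous ?a" "compact (closure {r. 0 < ?a r})"
    using is_fuzzy_membership[of a] unfolding is_fuzzy_number_def by auto
  have cvx: "convex {r. P (?a r)}" if P: "\<And>x y. P x \<Longrightarrow> x \<le> y \<Longrightarrow> P y" for P
  proof (rule convexI)
    fix x y u v :: real
    assume h: "x \<in> {r. P (?a r)}" "y \<in> {r. P (?a r)}" "0 \<le> u" "0 \<le> v" "u + v = 1"
    then have v: "v = 1 - u" by simp
    have "min (?a x) (?a y) \<le> ?a (u * x + v * y)"
      unfolding v using h by (intro F(3)) auto
    moreover have "P (min (?a x) (?a y))" using h by (auto simp: min_def)
    ultimately show "u *\<^sub>R x + v *\<^sub>R y \<in> {r. P (?a r)}" using P by auto
  qed
  have "compact (level a \<alpha>) \<and> convex (level a \<alpha>)"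
  proof (cases "\<alpha> = 0")
    case True
    then show ?thesis using F(5) cvx[of "\<lambda>x. 0 < x"] by (auto simp: level_def intro: convex_closure)
  next
    case False
    then have pos: "\<alpha> > 0" using assms by auto
    have "open {r. ?a r < \<alpha>}"
    proof (rule Topological_Spaces.openI)
      fix r assume "r \<in> {r. ?a r < \<alpha>}"
      then have "\<forall>\<^sub>F s in nhds r. ?a s < \<alpha>"
        using F(4) by (simp add: upper_semicontinuous_def)
      then obtain T where "open T" "r \<in> T" "\<And>s. s \<in> T \<Longrightarrow> ?a s < \<alpha>"
        unfolding eventually_nhds by blast
      then show "\<exists>T. open T \<and> r \<in> T \<and> T \<subseteq> {r. ?a r < \<alpha>}" by blast
    qed
    then have "closed {r. \<alpha> \<le> ?a r}"
      by (simp add: closed_def Compl_eq not_le)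
    moreover have "bounded {r. \<alpha> \<le> ?a r}"
      using bounded_subset[OF compact_imp_bounded[OF F(5)]] level_mono[of 0 \<alpha> a] False pos
      by (auto simp: level_def)
    ultimately show ?thesis
      using cvx[of "\<lambda>x. \<alpha> \<le> x"] False by (auto simp: level_def compact_eq_bounded_closed)
  qed
  then obtain p q where pq: "level a \<alpha> = {p..q}"
    using connected_compact_interval_1 convex_connected by metis
  obtain r0 where "?a r0 = 1" using F(2) by blast
  then have "r0 \<in> level a 1" by (auto simp: level_def)
  then have "r0 \<in> level a \<alpha>" using level_mono[of \<alpha> 1 a] assms by auto
  then have "p \<le> q" using pq by auto
  then show "level a \<alpha> = {lowr a \<alpha>..uppr a \<alpha>}" "lowr a \<alpha> \<le> uppr a \<alpha>"
    using pq by (auto simp: lowr_def uppr_def)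
qed

lemma lowr_mono:
  assumes "0 \<le> \<alpha>" "\<alpha> \<le> \<beta>" "\<beta> \<le> 1" shows "lowr a \<alpha> \<le> lowr a \<beta>"
proof -
  have "\<alpha> \<in> {0..1}" "\<beta> \<in> {0..1}" using assms by auto
  then show ?thesis
    using level_mono[OF assms(1,2), of a] level_interval[of \<alpha> a] level_interval[of \<beta> a]
    by (simp add: atLeastatMost_subset_iff)
qed

lemma uppr_antimono:
  assumes "0 \<le> \<alpha>" "\<alpha> \<le> \<beta>" "\<beta> \<le> 1" shows "uppr a \<beta> \<le> uppr a \<alpha>"
proof -
  have "\<alpha> \<in> {0..1}" "\<beta> \<in> {0..1}" using assms by auto
  then show ?thesis
    using level_mono[OF assms(1,2), of a] level_interval[of \<alpha> a] level_interval[of \<beta> a]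
    by (simp add: atLeastatMost_subset_iff)
qed

lemma fuzzy_eqI:
  assumes "\<And>\<alpha>. \<alpha> \<in> {0..1} \<Longrightarrow> level a \<alpha> = level b \<alpha>"
  shows "a = b"
proof -
  have le: "membership a r \<le> membership b r"
    if eq: "\<And>\<alpha>. \<alpha> \<in> {0..1} \<Longrightarrow> level a \<alpha> = level b \<alpha>" for a b r
  proof (cases "membership a r = 0")
    case True
    then show ?thesis using is_fuzzy_membership[of b] by (auto simp: is_fuzzy_number_def)
  next
    case False
    have "membership a r \<in> {0..1}" using is_fuzzy_membership[of a] by (auto simp: is_fuzzy_number_def)
    moreover have "r \<in> level a (membership a r)" using False by (simp add: level_def)
    ultimately have "r \<in> level b (membership a r)" using eq by simp
    then show ?thesis using False by (simp add: level_def)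
  qed
  have "membership a = membership b"
    using le[of a b] le[of b a] assms by (intro ext antisym) auto
  then show ?thesis by (simp add: membership_inject)
qed

lemma fuzzy_eq_iff:
  "a = b \<longleftrightarrow> (\<forall>\<alpha>\<in>{0..1}. lowr a \<alpha> = lowr b \<alpha> \<and> uppr a \<alpha> = uppr b \<alpha>)"
proof
  assume "\<forall>\<alpha>\<in>{0..1}. lowr a \<alpha> = lowr b \<alpha> \<and> uppr a \<alpha> = uppr b \<alpha>"
  then show "a = b" by (intro fuzzy_eqI) (simp add: level_interval(1))
qed simp

lemma lowr_left_continuous:
  assumes "0 < \<alpha>" "\<alpha> \<le> 1" "0 < e"
  shows "\<exists>\<beta>. 0 < \<beta> \<and> \<beta> < \<alpha> \<and> lowr a \<alpha> - e < lowr a \<beta>"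
proof -
  let ?x = "lowr a \<alpha> - e / 2"
  have "?x \<notin> level a \<alpha>" using level_interval[of \<alpha> a] assms by auto
  then have "membership a ?x < \<alpha>" using assms by (auto simp: level_def)
  then obtain \<beta> where b: "max 0 (membership a ?x) < \<beta>" "\<beta> < \<alpha>"
    using dense[of "max 0 (membership a ?x)" \<alpha>] assms by auto
  then have "?x \<notin> level a \<beta>" by (auto simp: level_def)
  moreover have "lowr a \<alpha> \<in> level a \<beta>"
    using level_interval[of \<alpha> a] level_mono[of \<beta> \<alpha> a] b assms by auto
  ultimately have "?x < lowr a \<beta>" using level_interval[of \<beta> a] b assms by auto
  then show ?thesis using b assms by (intro exI[of _ \<beta>]) auto
qed

lemma uppr_left_continuous:
  assumes "0 < \<alpha>" "\<alpha> \<le> 1" "0 < e"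
  shows "\<exists>\<beta>. 0 < \<beta> \<and> \<beta> < \<alpha> \<and> uppr a \<beta> < uppr a \<alpha> + e"
proof -
  let ?x = "uppr a \<alpha> + e / 2"
  have "?x \<notin> level a \<alpha>" using level_interval[of \<alpha> a] assms by auto
  then have "membership a ?x < \<alpha>" using assms by (auto simp: level_def)
  then obtain \<beta> where b: "max 0 (membership a ?x) < \<beta>" "\<beta> < \<alpha>"
    using dense[of "max 0 (membership a ?x)" \<alpha>] assms by auto
  then have "?x \<notin> level a \<beta>" by (auto simp: level_def)
  moreover have "uppr a \<alpha> \<in> level a \<beta>"
    using level_interval[of \<alpha> a] level_mono[of \<beta> \<alpha> a] b assms by auto
  ultimately have "uppr a \<beta> < ?x" using level_interval[of \<beta> a] b assms by auto
  then show ?thesis using b assms by (intro exI[of _ \<beta>]) auto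
qed

lemma level_right_continuous_0:
  assumes "x \<in> level a 0" "0 < e"
  shows "\<exists>\<beta>. 0 < \<beta> \<and> \<beta> \<le> 1 \<and> lowr a \<beta> < x + e \<and> x - e < uppr a \<beta>"
proof -
  obtain s where s: "0 < membership a s" "dist s x < e"
    using assms by (auto simp: level_def closure_approachable)
  let ?b = "membership a s"
  have b: "0 < ?b" "?b \<le> 1" using s is_fuzzy_membership[of a] by (auto simp: is_fuzzy_number_def)
  have "s \<in> level a ?b" using b by (simp add: level_def)
  then have "lowr a ?b \<le> s" "s \<le> uppr a ?b" using level_interval[of ?b a] b by auto
  then show ?thesis using s b by (intro exI[of _ ?b]) (auto simp: dist_real_def)
qed

lemma lowr_right_continuous_0:
  assumes "0 < e" shows "\<exists>\<beta>. 0 < \<beta> \<and> \<beta> \<le> 1 \<and> lowr a \<beta> < lowr a 0 + e"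
  using level_right_continuous_0[of "lowr a 0" a e] level_interval[of 0 a] assms by auto

lemma uppr_right_continuous_0:
  assumes "0 < e" shows "\<exists>\<beta>. 0 < \<beta> \<and> \<beta> \<le> 1 \<and> uppr a 0 - e < uppr a \<beta>"
  using level_right_continuous_0[of "uppr a 0" a e] level_interval[of 0 a] assms by auto

lemma fuzzy_of_levels:
  fixes l u :: "real \<Rightarrow> real"
  assumes l: "\<And>\<alpha> \<beta>. 0 \<le> \<alpha> \<Longrightarrow> \<alpha> \<le> \<beta> \<Longrightarrow> \<beta> \<le> 1 \<Longrightarrow> l \<alpha> \<le> l \<beta>"
    and u: "\<And>\<alpha> \<beta>. 0 \<le> \<alpha> \<Longrightarrow> \<alpha> \<le> \<beta> \<Longrightarrow> \<beta> \<le> 1 \<Longrightarrow> u \<beta> \<le> u \<alpha>"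
    and lu: "l 1 \<le> u 1"
    and ll: "\<And>\<alpha> e. 0 < \<alpha> \<Longrightarrow> \<alpha> \<le> 1 \<Longrightarrow> 0 < e \<Longrightarrow> \<exists>\<beta>. 0 < \<beta> \<and> \<beta> < \<alpha> \<and> l \<alpha> - e < l \<beta>"
    and ul: "\<And>\<alpha> e. 0 < \<alpha> \<Longrightarrow> \<alpha> \<le> 1 \<Longrightarrow> 0 < e \<Longrightarrow> \<exists>\<beta>. 0 < \<beta> \<and> \<beta> < \<alpha> \<and> u \<beta> < u \<alpha> + e"
    and lr: "\<And>e. 0 < e \<Longrightarrow> \<exists>\<beta>. 0 < \<beta> \<and> \<beta> \<le> 1 \<and> l \<beta> < l 0 + e"
    and ur: "\<And>e. 0 < e \<Longrightarrow> \<exists>\<beta>. 0 < \<beta> \<and> \<beta> \<le> 1 \<and> u 0 - e < u \<beta>"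
  shows "\<exists>c. \<forall>\<alpha>\<in>{0..1}. level c \<alpha> = {l \<alpha>..u \<alpha>}"
proof -
  define S where "S r = insert 0 {\<alpha>. 0 < \<alpha> \<and> \<alpha> \<le> 1 \<and> l \<alpha> \<le> r \<and> r \<le> u \<alpha>}" for r
  define c where "c r = Sup (S r)" for r
  have bdd: "bdd_above (S r)" for r by (rule bdd_aboveI[of _ 1]) (auto simp: S_def)
  have c01: "0 \<le> c r \<and> c r \<le> 1" for r
    unfolding c_def using bdd[of r] by (auto intro!: cSup_upper cSup_least simp: S_def)
  have lev: "\<alpha> \<le> c r \<longleftrightarrow> l \<alpha> \<le> r \<and> r \<le> u \<alpha>" if a: "0 < \<alpha>" "\<alpha> \<le> 1" for \<alpha> r
  proof
    assume "l \<alpha> \<le> r \<and> r \<le> u \<alpha>"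
    then show "\<alpha> \<le> c r" unfolding c_def using a by (intro cSup_upper bdd) (auto simp: S_def)
  next
    assume le: "\<alpha> \<le> c r"
    have below: "l \<beta> \<le> r \<and> r \<le> u \<beta>" if b: "0 < \<beta>" "\<beta> < \<alpha>" for \<beta>
    proof -
      have "\<beta> < Sup (S r)" using le b by (simp add: c_def)
      then obtain \<gamma> where "\<gamma> \<in> S r" "\<beta> < \<gamma>"
        using less_cSup_iff[OF _ bdd, of r \<beta>] by (auto simp: S_def)
      then show ?thesis using b l[of \<beta> \<gamma>] u[of \<beta> \<gamma>] by (auto simp: S_def)
    qed
    have "l \<alpha> \<le> r"
    proof (rule ccontr)
      assume "\<not> l \<alpha> \<le> r"
      then show False using ll[OF a, of "l \<alpha> - r"] below by force
    qed
    moreover have "r \<le> u \<alpha>"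
    proof (rule ccontr)
      assume "\<not> r \<le> u \<alpha>"
      then show False using ul[OF a, of "r - u \<alpha>"] below by force
    qed
    ultimately show "l \<alpha> \<le> r \<and> r \<le> u \<alpha>" by simp
  qed
  have supp: "0 < c r \<longleftrightarrow> (\<exists>\<alpha>. 0 < \<alpha> \<and> \<alpha> \<le> 1 \<and> l \<alpha> \<le> r \<and> r \<le> u \<alpha>)" for r
  proof
    assume "0 < c r"
    then show "\<exists>\<alpha>. 0 < \<alpha> \<and> \<alpha> \<le> 1 \<and> l \<alpha> \<le> r \<and> r \<le> u \<alpha>"
      using lev[of "c r" r] c01[of r] by auto
  next
    assume "\<exists>\<alpha>. 0 < \<alpha> \<and> \<alpha> \<le> 1 \<and> l \<alpha> \<le> r \<and> r \<le> u \<alpha>"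
    then show "0 < c r" using lev by force
  qed
  have lle: "l \<alpha> \<le> u \<alpha>" if "0 \<le> \<alpha>" "\<alpha> \<le> 1" for \<alpha>
    using l[of \<alpha> 1] u[of \<alpha> 1] lu that by auto
  have qc: "min (c r) (c s) \<le> c (t * r + (1 - t) * s)" if t: "t \<in> {0..1}" for r s t
  proof (cases "min (c r) (c s) = 0")
    case True then show ?thesis using c01 by simp
  next
    case False
    define m where "m = min (c r) (c s)"
    have m: "0 < m" "m \<le> 1" using False c01[of r] c01[of s] by (auto simp: m_def min_def)
    have "m \<le> c r" "m \<le> c s" by (auto simp: m_def)
    then have "r \<in> {l m..u m}" "s \<in> {l m..u m}" using lev[OF m] by auto
    then have "t *\<^sub>R r + (1 - t) *\<^sub>R s \<in> {l m..u m}"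
      using t by (intro convexD convex_real_interval) auto
    then show ?thesis using lev[OF m] by (auto simp: m_def)
  qed
  have clo: "closure {r. 0 < c r} = {l 0..u 0}"
  proof
    have "{r. 0 < c r} \<subseteq> {l 0..u 0}"
    proof
      fix r assume "r \<in> {r. 0 < c r}"
      then obtain \<alpha> where "0 < \<alpha>" "\<alpha> \<le> 1" "l \<alpha> \<le> r" "r \<le> u \<alpha>" using supp by auto
      then show "r \<in> {l 0..u 0}" using l[of 0 \<alpha>] u[of 0 \<alpha>] by auto
    qed
    then show "closure {r. 0 < c r} \<subseteq> {l 0..u 0}" by (intro closure_minimal) auto
    have cv: "convex (closure {r. 0 < c r})"
    proof (intro convex_closure convexI)
      fix x y p v :: real
      assume h: "x \<in> {r. 0 < c r}" "y \<in> {r. 0 < c r}" "0 \<le> p" "0 \<le> v" "p + v = 1"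
      then have v: "v = 1 - p" by simp
      have "min (c x) (c y) \<le> c (p * x + v * y)" unfolding v using h by (intro qc) auto
      moreover have "0 < min (c x) (c y)" using h by simp
      ultimately have "0 < c (p * x + v * y)" by (rule order.strict_trans2[rotated])
      then show "p *\<^sub>R x + v *\<^sub>R y \<in> {r. 0 < c r}" by simp
    qed
    have "l 0 \<in> closure {r. 0 < c r}"
      unfolding closure_approachable
    proof (intro allI impI)
      fix e :: real assume "0 < e"
      then obtain \<beta> where b: "0 < \<beta>" "\<beta> \<le> 1" "l \<beta> < l 0 + e" using lr by blast
      then show "\<exists>y\<in>{r. 0 < c r}. dist y (l 0) < e"
        using l[of 0 \<beta>] lle[of \<beta>] supp by (intro bexI[of _ "l \<beta>"]) (auto simp: dist_real_def)
    qed
    moreover have "u 0 \<in> closure {r. 0 < c r}"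
      unfolding closure_approachable
    proof (intro allI impI)
      fix e :: real assume "0 < e"
      then obtain \<beta> where b: "0 < \<beta>" "\<beta> \<le> 1" "u 0 - e < u \<beta>" using ur by blast
      then show "\<exists>y\<in>{r. 0 < c r}. dist y (u 0) < e"
        using u[of 0 \<beta>] lle[of \<beta>] supp by (intro bexI[of _ "u \<beta>"]) (auto simp: dist_real_def)
    qed
    ultimately have "closed_segment (l 0) (u 0) \<subseteq> closure {r. 0 < c r}"
      using cv by (rule closed_segment_subset)
    then show "{l 0..u 0} \<subseteq> closure {r. 0 < c r}"
      using lle[of 0] by (simp add: closed_segment_eq_real_ivl)
  qed
  have usc: "upper_semicontinuous c"
    unfolding upper_semicontinuous_def
  proof (intro allI impI)
    fix r y assume y: "c r < y"
    show "\<forall>\<^sub>F s in nhds r. c s < y"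
    proof (cases "y \<le> 1")
      case False
      then show ?thesis using c01 by (intro always_eventually allI) (meson le_less_trans not_le)
    next
      case True
      have "0 < y" using y c01[of r] by linarith
      then have eq: "c s < y \<longleftrightarrow> s \<in> - {l y..u y}" for s using lev[of y s] True by auto
      have "open (- {l y..u y})" by (intro open_Compl closed_real_atLeastAtMost)
      moreover have "r \<in> - {l y..u y}" using y eq by blast
      ultimately show ?thesis unfolding eq by (rule eventually_nhds_in_open)
    qed
  qed
  have "c (l 1) = 1" using lev[of 1 "l 1"] lu c01[of "l 1"] by auto
  then have "is_fuzzy_number c"
    unfolding is_fuzzy_number_def using c01 qc usc clo by auto
  then have mem: "membership (Abs_fuzzy c) = c" by (simp add: Abs_fuzzy_inverse)
  have "level (Abs_fuzzy c) \<alpha> = {l \<alpha>..u \<alpha>}" if "\<alpha> \<in> {0..1}" for \<alpha>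
    using that clo lev[of \<alpha>] by (auto simp: level_def mem)
  then show ?thesis by blast
qed

section \<open>Arithmetic, order and metric\<close>

definition fuzzy_add :: "fuzzy \<Rightarrow> fuzzy \<Rightarrow> fuzzy" (infixl \<open>\<oplus>\<close> 65) where
  "a \<oplus> b = (THE c. \<forall>\<alpha>\<in>{0..1}. level c \<alpha> = {lowr a \<alpha> + lowr b \<alpha> .. uppr a \<alpha> + uppr b \<alpha>})"

definition fuzzy_scale :: "real \<Rightarrow> fuzzy \<Rightarrow> fuzzy" (infixr \<open>\<odot>\<close> 75) where
  "s \<odot> a = (THE c. \<forall>\<alpha>\<in>{0..1}. level c \<alpha> =
     (if 0 \<le> s then {s * lowr a \<alpha> .. s * uppr a \<alpha>} else {s * uppr a \<alpha> .. s * lowr a \<alpha>}))"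

lemma the_level:
  assumes "\<exists>c. \<forall>\<alpha>\<in>{0..1}. level c \<alpha> = A \<alpha>" and "\<alpha> \<in> {0..1}"
  shows "level (THE c. \<forall>\<alpha>\<in>{0..1}. level c \<alpha> = A \<alpha>) \<alpha> = A \<alpha>"
proof -
  obtain c where c: "\<forall>\<alpha>\<in>{0..1}. level c \<alpha> = A \<alpha>" using assms by blast
  have "(THE c. \<forall>\<alpha>\<in>{0..1}. level c \<alpha> = A \<alpha>) = c"
    using c by (intro the_equality fuzzy_eqI) auto
  then show ?thesis using c assms(2) by simp
qed

lemma level_add:
  assumes "\<alpha> \<in> {0..1}"
  shows "level (a \<oplus> b) \<alpha> = {lowr a \<alpha> + lowr b \<alpha> .. uppr a \<alpha> + uppr b \<alpha>}"
  unfolding fuzzy_add_def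
proof (rule the_level[OF _ assms], rule fuzzy_of_levels)
  fix \<alpha> e :: real assume h: "0 < \<alpha>" "\<alpha> \<le> 1" "0 < e"
  obtain \<beta> \<gamma> where bc: "0 < \<beta>" "\<beta> < \<alpha>" "lowr a \<alpha> - e / 2 < lowr a \<beta>"
      "0 < \<gamma>" "\<gamma> < \<alpha>" "lowr b \<alpha> - e / 2 < lowr b \<gamma>"
    using lowr_left_continuous[OF h(1,2), of "e / 2"] h(3) by (metis half_gt_zero)
  then show "\<exists>\<beta>. 0 < \<beta> \<and> \<beta> < \<alpha> \<and> lowr a \<alpha> + lowr b \<alpha> - e < lowr a \<beta> + lowr b \<beta>"
    using lowr_mono[of \<beta> "max \<beta> \<gamma>" a] lowr_mono[of \<gamma> "max \<beta> \<gamma>" b] h(2)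
    by (intro exI[of _ "max \<beta> \<gamma>"]) auto
next
  fix \<alpha> e :: real assume h: "0 < \<alpha>" "\<alpha> \<le> 1" "0 < e"
  obtain \<beta> \<gamma> where bc: "0 < \<beta>" "\<beta> < \<alpha>" "uppr a \<beta> < uppr a \<alpha> + e / 2"
      "0 < \<gamma>" "\<gamma> < \<alpha>" "uppr b \<gamma> < uppr b \<alpha> + e / 2"
    using uppr_left_continuous[OF h(1,2), of "e / 2"] h(3) by (metis half_gt_zero)
  then show "\<exists>\<beta>. 0 < \<beta> \<and> \<beta> < \<alpha> \<and> uppr a \<beta> + uppr b \<beta> < uppr a \<alpha> + uppr b \<alpha> + e"
    using uppr_antimono[of \<beta> "max \<beta> \<gamma>" a] uppr_antimono[of \<gamma> "max \<beta> \<gamma>" b] h(2)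
    by (intro exI[of _ "max \<beta> \<gamma>"]) auto
next
  fix e :: real assume h: "0 < e"
  obtain \<beta> \<gamma> where bc: "0 < \<beta>" "\<beta> \<le> 1" "lowr a \<beta> < lowr a 0 + e / 2"
      "0 < \<gamma>" "\<gamma> \<le> 1" "lowr b \<gamma> < lowr b 0 + e / 2"
    using lowr_right_continuous_0[of "e / 2"] h by (metis half_gt_zero)
  then show "\<exists>\<beta>. 0 < \<beta> \<and> \<beta> \<le> 1 \<and> lowr a \<beta> + lowr b \<beta> < lowr a 0 + lowr b 0 + e"
    using lowr_mono[of "min \<beta> \<gamma>" \<beta> a] lowr_mono[of "min \<beta> \<gamma>" \<gamma> b]
    by (intro exI[of _ "min \<beta> \<gamma>"]) auto
next
  fix e :: real assume h: "0 < e"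
  obtain \<beta> \<gamma> where bc: "0 < \<beta>" "\<beta> \<le> 1" "uppr a 0 - e / 2 < uppr a \<beta>"
      "0 < \<gamma>" "\<gamma> \<le> 1" "uppr b 0 - e / 2 < uppr b \<gamma>"
    using uppr_right_continuous_0[of "e / 2"] h by (metis half_gt_zero)
  then show "\<exists>\<beta>. 0 < \<beta> \<and> \<beta> \<le> 1 \<and> uppr a 0 + uppr b 0 - e < uppr a \<beta> + uppr b \<beta>"
    using uppr_antimono[of "min \<beta> \<gamma>" \<beta> a] uppr_antimono[of "min \<beta> \<gamma>" \<gamma> b]
    by (intro exI[of _ "min \<beta> \<gamma>"]) auto
qed (auto intro!: add_mono lowr_mono uppr_antimono level_interval(2))

lemma level_scale:
  assumes "\<alpha> \<in> {0..1}"
  shows "level (s \<odot> a) \<alpha> =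
     (if 0 \<le> s then {s * lowr a \<alpha> .. s * uppr a \<alpha>} else {s * uppr a \<alpha> .. s * lowr a \<alpha>})"
  unfolding fuzzy_scale_def
proof (rule the_level[OF _ assms])
  consider "s = 0" | "0 < s" | "s < 0" by linarith
  then show "\<exists>c. \<forall>\<alpha>\<in>{0..1}. level c \<alpha> =
     (if 0 \<le> s then {s * lowr a \<alpha> .. s * uppr a \<alpha>} else {s * uppr a \<alpha> .. s * lowr a \<alpha>})"
  proof cases
    case 1
    have "\<exists>\<beta>>0. \<beta> < \<alpha>" if "0 < \<alpha>" for \<alpha> :: real using dense[OF that] by auto
    moreover have "\<exists>\<beta>>0. \<beta> \<le> (1::real)" by (intro exI[of _ 1]) auto
    ultimately have "\<exists>c. \<forall>\<alpha>\<in>{0..1}. level c \<alpha> = {0..0}"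
      by (intro fuzzy_of_levels) auto
    then show ?thesis using 1 by simp
  next
    case 2
    have "\<exists>c. \<forall>\<alpha>\<in>{0..1}. level c \<alpha> = {s * lowr a \<alpha> .. s * uppr a \<alpha>}"
    proof (rule fuzzy_of_levels)
      fix \<alpha> e :: real assume h: "0 < \<alpha>" "\<alpha> \<le> 1" "0 < e"
      show "\<exists>\<beta>. 0 < \<beta> \<and> \<beta> < \<alpha> \<and> s * lowr a \<alpha> - e < s * lowr a \<beta>"
        using lowr_left_continuous[OF h(1,2), of "e / s" a] h 2 by (auto simp: field_simps)
      show "\<exists>\<beta>. 0 < \<beta> \<and> \<beta> < \<alpha> \<and> s * uppr a \<beta> < s * uppr a \<alpha> + e"
        using uppr_left_continuous[OF h(1,2), of "e / s" a] h 2 by (auto simp: field_simps)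
    next
      fix e :: real assume h: "0 < e"
      show "\<exists>\<beta>. 0 < \<beta> \<and> \<beta> \<le> 1 \<and> s * lowr a \<beta> < s * lowr a 0 + e"
        using lowr_right_continuous_0[of "e / s" a] h 2 by (auto simp: field_simps)
      show "\<exists>\<beta>. 0 < \<beta> \<and> \<beta> \<le> 1 \<and> s * uppr a 0 - e < s * uppr a \<beta>"
        using uppr_right_continuous_0[of "e / s" a] h 2 by (auto simp: field_simps)
    qed (use 2 in \<open>auto intro!: mult_left_mono lowr_mono uppr_antimono level_interval(2)\<close>)
    then show ?thesis using 2 by simp
  next
    case 3
    have "\<exists>c. \<forall>\<alpha>\<in>{0..1}. level c \<alpha> = {s * uppr a \<alpha> .. s * lowr a \<alpha>}"
    proof (rule fuzzy_of_levels)
      fix \<alpha> e :: real assume h: "0 < \<alpha>" "\<alpha> \<le> 1" "0 < e"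
      have e: "0 < e / - s" using h 3 by (simp add: divide_pos_neg)
      show "\<exists>\<beta>. 0 < \<beta> \<and> \<beta> < \<alpha> \<and> s * uppr a \<alpha> - e < s * uppr a \<beta>"
        using uppr_left_continuous[OF h(1,2) e, of a] 3 by (auto simp: field_simps)
      show "\<exists>\<beta>. 0 < \<beta> \<and> \<beta> < \<alpha> \<and> s * lowr a \<beta> < s * lowr a \<alpha> + e"
        using lowr_left_continuous[OF h(1,2) e, of a] 3 by (auto simp: field_simps)
    next
      fix e :: real assume h: "0 < e"
      have e: "0 < e / - s" using h 3 by (simp add: divide_pos_neg)
      show "\<exists>\<beta>. 0 < \<beta> \<and> \<beta> \<le> 1 \<and> s * uppr a \<beta> < s * uppr a 0 + e"
        using uppr_right_continuous_0[OF e, of a] 3 by (auto simp: field_simps)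
      show "\<exists>\<beta>. 0 < \<beta> \<and> \<beta> \<le> 1 \<and> s * lowr a 0 - e < s * lowr a \<beta>"
        using lowr_right_continuous_0[OF e, of a] 3 by (auto simp: field_simps)
    qed (use 3 in \<open>auto intro!: mult_left_mono_neg lowr_mono uppr_antimono level_interval(2)\<close>)
    then show ?thesis using 3 by simp
  qed
qed

lemma endpoints_add:
  assumes "\<alpha> \<in> {0..1}"
  shows "lowr (a \<oplus> b) \<alpha> = lowr a \<alpha> + lowr b \<alpha>" "uppr (a \<oplus> b) \<alpha> = uppr a \<alpha> + uppr b \<alpha>"
  unfolding lowr_def[of "a \<oplus> b"] uppr_def[of "a \<oplus> b"] level_add[OF assms]
  using add_mono[OF level_interval(2)[OF assms, of a] level_interval(2)[OF assms, of b]] by simp_all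

lemma endpoints_scale:
  assumes "\<alpha> \<in> {0..1}"
  shows "lowr (s \<odot> a) \<alpha> = (if 0 \<le> s then s * lowr a \<alpha> else s * uppr a \<alpha>)"
    and "uppr (s \<odot> a) \<alpha> = (if 0 \<le> s then s * uppr a \<alpha> else s * lowr a \<alpha>)"
  unfolding lowr_def[of "s \<odot> a"] uppr_def[of "s \<odot> a"] level_scale[OF assms]
  using mult_left_mono[OF level_interval(2)[OF assms, of a], of s]
    mult_left_mono_neg[OF level_interval(2)[OF assms, of a], of s]
  by (cases "0 \<le> s"; simp del: mult_le_cancel_left mult_le_cancel_left_pos mult_le_cancel_left_neg)+

definition fuzzy_le :: "fuzzy \<Rightarrow> fuzzy \<Rightarrow> bool" (infix \<open>\<preceq>\<close> 50) where
  "a \<preceq> b \<longleftrightarrow> integral {0..1} (\<lambda>\<alpha>. \<alpha> * (lowr a \<alpha> + uppr a \<alpha>))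
            \<le> integral {0..1} (\<lambda>\<alpha>. \<alpha> * (lowr b \<alpha> + uppr b \<alpha>))"

instantiation fuzzy :: metric_space
begin

definition dist_fuzzy :: "fuzzy \<Rightarrow> fuzzy \<Rightarrow> real" where
  "dist_fuzzy a b = (SUP \<alpha>\<in>{0..1}. max \<bar>lowr a \<alpha> - lowr b \<alpha>\<bar> \<bar>uppr a \<alpha> - uppr b \<alpha>\<bar>)"

definition uniformity_fuzzy :: "(fuzzy \<times> fuzzy) filter" where
  "uniformity_fuzzy = (INF e\<in>{0<..}. principal {(x, y). dist x y < e})"

definition open_fuzzy :: "fuzzy set \<Rightarrow> bool" where
  "open_fuzzy U \<longleftrightarrow> (\<forall>x\<in>U. eventually (\<lambda>(x', y). x' = x \<longrightarrow> y \<in> U) uniformity)"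

instance
proof
  have bdd: "bdd_above ((\<lambda>\<alpha>. max \<bar>lowr a \<alpha> - lowr b \<alpha>\<bar> \<bar>uppr a \<alpha> - uppr b \<alpha>\<bar>) ` {0..1})"
    for a b :: fuzzy
  proof (rule bdd_aboveI2)
    fix \<alpha> :: real assume "\<alpha> \<in> {0..1}"
    then show "max \<bar>lowr a \<alpha> - lowr b \<alpha>\<bar> \<bar>uppr a \<alpha> - uppr b \<alpha>\<bar>
        \<le> \<bar>lowr a 0\<bar> + \<bar>uppr a 0\<bar> + \<bar>lowr b 0\<bar> + \<bar>uppr b 0\<bar>"
      using lowr_mono[of 0 \<alpha> a] lowr_mono[of 0 \<alpha> b] uppr_antimono[of 0 \<alpha> a] uppr_antimono[of 0 \<alpha> b]
        level_interval(2)[of \<alpha> a] level_interval(2)[of \<alpha> b] by auto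
  qed
  have upper: "\<bar>lowr a \<alpha> - lowr b \<alpha>\<bar> \<le> dist a b" "\<bar>uppr a \<alpha> - uppr b \<alpha>\<bar> \<le> dist a b"
    if "\<alpha> \<in> {0..1}" for a b :: fuzzy and \<alpha>
    using cSUP_upper[OF that bdd[of a b]] unfolding dist_fuzzy_def by auto
  fix x y z :: fuzzy
  show "dist x y = 0 \<longleftrightarrow> x = y"
  proof
    assume "dist x y = 0"
    then show "x = y" using upper[of _ x y] by (auto simp: fuzzy_eq_iff)
  qed (simp add: dist_fuzzy_def)
  show "dist x y \<le> dist x z + dist y z"
    unfolding dist_fuzzy_def[of x y]
  proof (rule cSUP_least)
    fix \<alpha> :: real assume "\<alpha> \<in> {0..1}"
    then show "max \<bar>lowr x \<alpha> - lowr y \<alpha>\<bar> \<bar>uppr x \<alpha> - uppr y \<alpha>\<bar> \<le> dist x z + dist y z"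
      using upper[of \<alpha> x z] upper[of \<alpha> y z] by auto
  qed simp
qed (simp_all add: uniformity_fuzzy_def open_fuzzy_def)

end

section \<open>Generalized Hukuhara difference and differentiability\<close>

definition is_gH_diff :: "fuzzy \<Rightarrow> fuzzy \<Rightarrow> fuzzy \<Rightarrow> bool" where
  "is_gH_diff a b c \<longleftrightarrow> a = b \<oplus> c \<or> b = a \<oplus> ((- 1) \<odot> c)"

definition gH_diff_exists :: "fuzzy \<Rightarrow> fuzzy \<Rightarrow> bool" where
  "gH_diff_exists a b \<longleftrightarrow> (\<exists>c. is_gH_diff a b c)"

definition gH_diff :: "fuzzy \<Rightarrow> fuzzy \<Rightarrow> fuzzy" (infixl \<open>\<ominus>\<^sub>g\<^sub>H\<close> 65) where
  "a \<ominus>\<^sub>g\<^sub>H b = (THE c. is_gH_diff a b c)"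

lemma is_gH_diff_level:
  assumes "is_gH_diff a b c" and al: "\<alpha> \<in> {0..1}"
  shows "level c \<alpha> = {min (lowr a \<alpha> - lowr b \<alpha>) (uppr a \<alpha> - uppr b \<alpha>) ..
                      max (lowr a \<alpha> - lowr b \<alpha>) (uppr a \<alpha> - uppr b \<alpha>)}"
proof -
  note I = level_interval[OF al]
  have le: "lowr a \<alpha> \<le> uppr a \<alpha>" "lowr b \<alpha> \<le> uppr b \<alpha>" "lowr c \<alpha> \<le> uppr c \<alpha>" using I by auto
  consider "a = b \<oplus> c" | "b = a \<oplus> ((- 1) \<odot> c)" using assms by (auto simp: is_gH_diff_def)
  then show ?thesis
  proof cases
    case 1
    then have "lowr a \<alpha> = lowr b \<alpha> + lowr c \<alpha>" "uppr a \<alpha> = uppr b \<alpha> + uppr c \<alpha>"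
      using endpoints_add[OF al, of b c] by simp_all
    then show ?thesis using le I(1)[of c] by simp
  next
    case 2
    then have "lowr b \<alpha> = lowr a \<alpha> - uppr c \<alpha>" "uppr b \<alpha> = uppr a \<alpha> - lowr c \<alpha>"
      using endpoints_add[OF al, of a "(- 1) \<odot> c"] endpoints_scale[OF al, of "- 1" c] by simp_all
    then show ?thesis using le I(1)[of c] by simp
  qed
qed

lemma gH_diff_eq:
  assumes "is_gH_diff a b c" shows "a \<ominus>\<^sub>g\<^sub>H b = c"
  unfolding gH_diff_def
  using assms by (intro the_equality fuzzy_eqI) (auto simp: is_gH_diff_level)

definition has_gH_derivative :: "(real \<Rightarrow> fuzzy) \<Rightarrow> fuzzy \<Rightarrow> real \<Rightarrow> bool" where
  "has_gH_derivative g c x\<^sub>0 \<longleftrightarrow>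
     (\<forall>\<^sub>F h in at 0. gH_diff_exists (g (x\<^sub>0 + h)) (g x\<^sub>0)) \<and>
     ((\<lambda>h. (1 / h) \<odot> (g (x\<^sub>0 + h) \<ominus>\<^sub>g\<^sub>H g x\<^sub>0)) \<longlongrightarrow> c) (at 0)"

definition section_at :: "'n \<Rightarrow> (real ^ 'n \<Rightarrow> 'b) \<Rightarrow> real ^ 'n \<Rightarrow> real \<Rightarrow> 'b" where
  "section_at i f x t = f (\<chi> k. if k = i then t else x $ k)"

text \<open>
  Functions on an open set are rendered as total functions. All notions below depend only on the
  values near the point in question, so values outside the open set are irrelevant.
\<close>

definition has_gH_partial :: "'n \<Rightarrow> (real ^ 'n \<Rightarrow> fuzzy) \<Rightarrow> fuzzy \<Rightarrow> real ^ 'n \<Rightarrow> bool" where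
  "has_gH_partial i f c x \<longleftrightarrow> has_gH_derivative (section_at i f x) c (x $ i)"

definition gH_partial_exists :: "'n \<Rightarrow> (real ^ 'n \<Rightarrow> fuzzy) \<Rightarrow> real ^ 'n \<Rightarrow> bool" where
  "gH_partial_exists i f x \<longleftrightarrow> (\<exists>c. has_gH_partial i f c x)"

definition gH_partial :: "'n \<Rightarrow> (real ^ 'n \<Rightarrow> fuzzy) \<Rightarrow> real ^ 'n \<Rightarrow> fuzzy" where
  "gH_partial i f x = (THE c. has_gH_partial i f c x)"

lemma gH_partial_eq:
  assumes "has_gH_partial i f c x" shows "gH_partial i f x = c"
  unfolding gH_partial_def using assms
  by (intro the_equality) (auto simp: has_gH_partial_def has_gH_derivative_def
      intro: tendsto_unique[OF trivial_limit_at])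

definition gH_differentiable_at :: "(real ^ 'n::finite \<Rightarrow> fuzzy) \<Rightarrow> real ^ 'n \<Rightarrow> bool" where
  "gH_differentiable_at f x \<longleftrightarrow>
     (\<exists>i. gH_partial_exists i f x \<and>
          (\<forall>j. j \<noteq> i \<longrightarrow> (\<forall>\<^sub>F y in nhds x. gH_partial_exists j f y) \<and> isCont (gH_partial j f) x))"

definition gH_differentiable_on :: "(real ^ 'n::finite \<Rightarrow> fuzzy) \<Rightarrow> (real ^ 'n) set \<Rightarrow> bool" where
  "gH_differentiable_on f X \<longleftrightarrow> (\<forall>x\<in>X. gH_differentiable_at f x)"

text \<open>The second-order notions presuppose that the gradient is defined on all of \<open>X\<close>.\<close>

definition twice_gH_differentiable_at ::
    "(real ^ 'n::finite \<Rightarrow> fuzzy) \<Rightarrow> (real ^ 'n) set \<Rightarrow> real ^ 'n \<Rightarrow> bool" where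
  "twice_gH_differentiable_at f X x \<longleftrightarrow>
     gH_differentiable_on f X \<and> (\<forall>i. gH_differentiable_at (gH_partial i f) x)"

definition gH_partial2 ::
    "'n \<Rightarrow> 'n \<Rightarrow> (real ^ 'n::finite \<Rightarrow> fuzzy) \<Rightarrow> real ^ 'n \<Rightarrow> fuzzy" where
  "gH_partial2 i j f = gH_partial j (gH_partial i f)"

definition twice_continuously_gH_differentiable_on ::
    "(real ^ 'n::finite \<Rightarrow> fuzzy) \<Rightarrow> (real ^ 'n) set \<Rightarrow> bool" where
  "twice_continuously_gH_differentiable_on f X \<longleftrightarrow>
     (\<forall>x\<in>X. twice_gH_differentiable_at f X x) \<and>
     (\<forall>i j. continuous_on X (gH_partial2 i j f))"

definition local_minimizer ::
    "(real ^ 'n::finite \<Rightarrow> fuzzy) \<Rightarrow> (real ^ 'n) set \<Rightarrow> real ^ 'n \<Rightarrow> bool" where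
  "local_minimizer f X x\<^sub>0 \<longleftrightarrow>
     x\<^sub>0 \<in> X \<and> (\<exists>\<epsilon>>0. \<forall>x\<in>X. norm (x - x\<^sub>0) < \<epsilon> \<longrightarrow> f x\<^sub>0 \<preceq> f x)"

section \<open>Hessian matrices and positive semi-definiteness\<close>

definition partial_exists :: "'n \<Rightarrow> (real ^ 'n \<Rightarrow> real) \<Rightarrow> real ^ 'n \<Rightarrow> bool" where
  "partial_exists i \<phi> x \<longleftrightarrow> section_at i \<phi> x differentiable at (x $ i)"

definition partial :: "'n \<Rightarrow> (real ^ 'n \<Rightarrow> real) \<Rightarrow> real ^ 'n \<Rightarrow> real" where
  "partial i \<phi> x = deriv (section_at i \<phi> x) (x $ i)"

definition hessian_exists :: "(real ^ 'n::finite \<Rightarrow> real) \<Rightarrow> real ^ 'n \<Rightarrow> bool" where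
  "hessian_exists \<phi> x \<longleftrightarrow>
     (\<forall>i. \<forall>\<^sub>F y in nhds x. partial_exists i \<phi> y) \<and> (\<forall>i j. partial_exists j (partial i \<phi>) x)"

definition hessian :: "(real ^ 'n::finite \<Rightarrow> real) \<Rightarrow> real ^ 'n \<Rightarrow> real ^ 'n ^ 'n" where
  "hessian \<phi> x = (\<chi> i j. partial j (partial i \<phi>) x)"

definition pos_semidefinite :: "real ^ 'n ^ 'n::finite \<Rightarrow> bool" where
  "pos_semidefinite A \<longleftrightarrow> transpose A = A \<and> (\<forall>v. 0 \<le> v \<bullet> (A *v v))"

end

theory Submission
  imports Defs
begin

text \<open>
  A gH-difference can only swap the two endpoint differences, so the sum of the endpoints of a
  level set is additive and homogeneous even though the endpoints themselves are not; it is also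
  Lipschitz for the metric. The same holds for the functional \<open>\<integral>\<alpha>(a\<^sup>L + a\<^sup>U)d\<alpha>\<close> that defines the
  order. Functionals of this kind turn gH-partial derivatives into ordinary partial derivatives.
  Hence the integrated Hessian is the ordinary Hessian of a real \<open>C\<^sup>2\<close> function with a local
  minimum.
\<close>

section \<open>Real functions with continuous partial derivatives\<close>

lemma section_at_shift: "section_at i F x (x $ i + s) = F (x + s *\<^sub>R axis i 1)"
  unfolding section_at_def by (rule arg_cong[of _ _ F]) (auto simp: vec_eq_iff axis_def)

text \<open>Trades the coordinate slice, taken at parameter \<open>x $ i\<close>, for the line
  through \<open>x\<close> in direction \<open>axis i 1\<close> at parameter 0; the calculus below
  is stated in that form.\<close>

lemma section_at_has_derivative_iff:
  "(section_at i F x has_real_derivative d) (at (x $ i)) \<longleftrightarrow>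
   ((\<lambda>s. F (x + s *\<^sub>R axis i 1)) has_real_derivative d) (at 0)"
proof -
  have "(section_at i F x has_real_derivative d) (at (x $ i)) \<longleftrightarrow>
        ((\<lambda>s. section_at i F x (s + x $ i)) has_real_derivative d) (at 0)"
    using DERIV_shift[of "section_at i F x" d 0 "x $ i"] by simp
  then show ?thesis by (simp add: section_at_shift add.commute[of _ "x $ i"])
qed

text \<open>Moving along the line by \<open>t\<close> is a change of base point, so it is enough to
  assume derivatives at parameter 0 for every base point.\<close>

lemma line_derivative_shift:
  fixes F :: "'a::real_vector \<Rightarrow> real"
  assumes "((\<lambda>s. F ((y + t *\<^sub>R e) + s *\<^sub>R e)) has_real_derivative d) (at 0)"
  shows "((\<lambda>s. F (y + s *\<^sub>R e)) has_real_derivative d) (at t)"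
proof -
  have "(\<lambda>s. F (y + (s + t) *\<^sub>R e)) = (\<lambda>s. F ((y + t *\<^sub>R e) + s *\<^sub>R e))"
    by (auto simp: algebra_simps)
  then show ?thesis
    using assms DERIV_shift[of "\<lambda>s. F (y + s *\<^sub>R e)" d 0 t] by simp
qed

text \<open>\<open>closed_segment\<close> covers both orders of the endpoints, so a coordinate
  increment \<open>v $ i\<close> of either sign can be treated at once.\<close>

lemma mvt_closed_segment:
  fixes f :: "real \<Rightarrow> real"
  assumes "\<And>t. t \<in> closed_segment a b \<Longrightarrow> (f has_real_derivative f' t) (at t)"
  shows "\<exists>t\<in>closed_segment a b. f b - f a = (b - a) * f' t"
proof (cases "a \<le> b")
  case True
  have "\<exists>t\<in>{a..b}. f b - f a = f' t * (b - a)"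
  proof (rule mvt_very_simple[OF True, of f "\<lambda>t h. f' t * h"])
    fix t assume "a \<le> t" "t \<le> b"
    then show "(f has_derivative (*) (f' t)) (at t within {a..b})"
      using assms[of t] True
      by (auto simp: has_field_derivative_def closed_segment_eq_real_ivl intro: has_derivative_at_withinI)
  qed
  then show ?thesis using True by (auto simp: closed_segment_eq_real_ivl mult.commute)
next
  case False
  have "\<exists>t\<in>{b..a}. f a - f b = f' t * (a - b)"
  proof (rule mvt_very_simple[of b a f "\<lambda>t h. f' t * h"])
    fix t assume "b \<le> t" "t \<le> a"
    then show "(f has_derivative (*) (f' t)) (at t within {b..a})"
      using assms[of t] False
      by (auto simp: has_field_derivative_def closed_segment_eq_real_ivl intro: has_derivative_at_withinI)
  qed (use False in simp)
  then obtain t where "t \<in> {b..a}" "f a - f b = f' t * (a - b)" by blast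
  moreover from this(2) have "f b - f a = (b - a) * f' t" by (simp add: algebra_simps)
  ultimately show ?thesis using False by (auto simp: closed_segment_eq_real_ivl)
qed

text \<open>Move from \<open>x\<close> to \<open>x + v\<close> one coordinate at a time. The mean
  value theorem turns each move into \<open>v $ i\<close> times \<open>G i\<close> at a nearby
  point, and continuity at \<open>x\<close> replaces that value by \<open>G i x\<close> up to a
  small error.\<close>

lemma has_derivative_continuous_partials:
  fixes F :: "real ^ 'n::finite \<Rightarrow> real"
  assumes X: "open X" "x \<in> X"
    and der: "\<And>i y. y \<in> X \<Longrightarrow> ((\<lambda>s. F (y + s *\<^sub>R axis i 1)) has_real_derivative G i y) (at 0)"
    and cont: "\<And>i. isCont (G i) x"
  shows "(F has_derivative (\<lambda>v. \<Sum>i\<in>UNIV. v $ i * G i x)) (at x)"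
  unfolding has_derivative_at_alt
proof (intro conjI allI impI)
  show "bounded_linear (\<lambda>v. \<Sum>i\<in>UNIV. v $ i * G i x)"
    by (intro bounded_linear_sum bounded_linear_mult_const bounded_linear_vec_nth)
  fix e :: real assume e: "0 < e"
  \<comment> \<open>The \<open>CARD('n)\<close> coordinate moves each cost at most
    \<open>e' * norm v\<close>, which adds up to \<open>e * norm v\<close>.\<close>
  define e' where "e' = e / real CARD('n)"
  have e': "e' > 0" using e by (simp add: e'_def)
  have "\<forall>\<^sub>F y in nhds x. y \<in> X \<and> (\<forall>i. dist (G i y) (G i x) < e')"
  proof (intro eventually_conj eventually_all_finite)
    show "\<forall>\<^sub>F y in nhds x. y \<in> X" using X by (rule eventually_nhds_in_open)
    show "\<forall>\<^sub>F y in nhds x. dist (G i y) (G i x) < e'" for i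
      using cont e' by (metis isCont_def tendsto_at_iff_tendsto_nhds tendstoD)
  qed
  then obtain d where d: "d > 0"
    and near: "\<And>y. dist y x < d \<Longrightarrow> y \<in> X \<and> (\<forall>i. dist (G i y) (G i x) < e')"
    unfolding eventually_nhds_metric by blast
  \<comment> \<open>\<open>K\<close> is the set of coordinates already moved;
    \<open>K = UNIV\<close> gives the full increment.\<close>
  have main: "\<bar>F (x + (\<Sum>i\<in>K. v $ i *\<^sub>R axis i 1)) - F x - (\<Sum>i\<in>K. v $ i * G i x)\<bar>
      \<le> real (card K) * (e' * norm v)" if v: "norm v < d" for v K
  proof (induction K rule: finite_induct[OF finite])
    case (2 i K)
    let ?w = "\<Sum>i\<in>K. v $ i *\<^sub>R axis i (1::real)"
    have w: "?w $ k = (if k \<in> K then v $ k else 0)" for k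
      by (simp add: axis_def if_distrib[of "\<lambda>z. _ * z"] sum.delta cong: if_cong)
    \<comment> \<open>Since \<open>i\<close> is not in \<open>K\<close>, no component of the partial
      increment exceeds that of \<open>v\<close> in absolute value, so the whole path stays in the
      ball.\<close>
    have close: "dist (x + ?w + s *\<^sub>R axis i 1) x < d" if "s \<in> closed_segment 0 (v $ i)" for s
    proof -
      have s: "\<bar>s\<bar> \<le> \<bar>v $ i\<bar>" using that by (auto simp: closed_segment_eq_real_ivl split: if_splits)
      have "norm (?w + s *\<^sub>R axis i 1) \<le> norm v"
      proof (rule norm_le_componentwise_cart)
        fix k
        have "(?w + s *\<^sub>R axis i 1) $ k = (if k \<in> K then v $ k else 0) + (if k = i then s else 0)"
          unfolding vector_add_component w by (simp add: axis_def)
        then show "norm ((?w + s *\<^sub>R axis i 1) $ k) \<le> norm (v $ k)" using s 2(2) by auto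
      qed
      then show ?thesis using v by (simp add: dist_norm add.assoc)
    qed
    have "\<exists>t\<in>closed_segment 0 (v $ i). F (x + ?w + (v $ i) *\<^sub>R axis i 1) - F (x + ?w + 0 *\<^sub>R axis i 1)
        = (v $ i - 0) * G i (x + ?w + t *\<^sub>R axis i 1)"
      by (rule mvt_closed_segment, rule line_derivative_shift, rule der) (use close near in blast)
    then obtain t where t: "t \<in> closed_segment 0 (v $ i)"
      and mv: "F (x + ?w + (v $ i) *\<^sub>R axis i 1) - F (x + ?w) = v $ i * G i (x + ?w + t *\<^sub>R axis i 1)"
      by auto
    have "\<bar>G i (x + ?w + t *\<^sub>R axis i 1) - G i x\<bar> \<le> e'"
      using near[OF close[OF t]] by (auto simp: dist_real_def less_imp_le)
    then have "\<bar>v $ i * (G i (x + ?w + t *\<^sub>R axis i 1) - G i x)\<bar> \<le> norm v * e'"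
      unfolding abs_mult by (intro mult_mono component_le_norm_cart) auto
    then have "\<bar>F (x + ?w + (v $ i) *\<^sub>R axis i 1) - F (x + ?w) - v $ i * G i x\<bar> \<le> e' * norm v"
      unfolding mv by (simp add: algebra_simps)
    then have "\<bar>F (x + ?w + (v $ i) *\<^sub>R axis i 1) - F x - (v $ i * G i x + (\<Sum>i\<in>K. v $ i * G i x))\<bar>
        \<le> e' * norm v + real (card K) * (e' * norm v)"
      using 2(3) by linarith
    then show ?case using 2 by (simp add: algebra_simps)
  qed simp
  show "\<exists>d>0. \<forall>y. norm (y - x) < d \<longrightarrow>
      norm (F y - F x - (\<Sum>i\<in>UNIV. (y - x) $ i * G i x)) \<le> e * norm (y - x)"
  proof (intro exI conjI allI impI)
    fix y assume "norm (y - x) < d"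
    then have "\<bar>F (x + (\<Sum>i\<in>UNIV. (y - x) $ i *\<^sub>R axis i 1)) - F x - (\<Sum>i\<in>UNIV. (y - x) $ i * G i x)\<bar>
      \<le> real CARD('n) * (e' * norm (y - x))" by (rule main)
    moreover have "(\<Sum>i\<in>UNIV. (y - x) $ i *\<^sub>R axis i 1) = y - x"
      using basis_expansion[of "y - x"] by (simp add: scalar_mult_eq_scaleR)
    ultimately show "norm (F y - F x - (\<Sum>i\<in>UNIV. (y - x) $ i * G i x)) \<le> e * norm (y - x)"
      by (simp add: e'_def)
  qed (rule d)
qed

section \<open>Symmetry of mixed second derivatives\<close>

lemma second_difference_mvt:
  fixes F :: "'a::real_normed_vector \<Rightarrow> real"
  assumes X: "\<And>y. dist y x < d \<Longrightarrow> y \<in> X"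
    and F: "\<And>y. y \<in> X \<Longrightarrow> ((\<lambda>s. F (y + s *\<^sub>R a)) has_real_derivative G y) (at 0)"
    and G: "\<And>y. y \<in> X \<Longrightarrow> ((\<lambda>s. G (y + s *\<^sub>R b)) has_real_derivative H y) (at 0)"
    and ab: "norm a \<le> 1" "norm b \<le> 1" and s: "0 < s" "2 * s < d"
  shows "\<exists>z. dist z x < d \<and>
    F (x + s *\<^sub>R a + s *\<^sub>R b) - F (x + s *\<^sub>R a) - F (x + s *\<^sub>R b) + F x = s * s * H z"
proof -
  have near: "dist (x + t *\<^sub>R a + r *\<^sub>R b) x < d" if "t \<in> {0..s}" "r \<in> {0..s}" for t r
  proof -
    have "norm (t *\<^sub>R a + r *\<^sub>R b) \<le> \<bar>t\<bar> * norm a + \<bar>r\<bar> * norm b"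
      by (rule order_trans[OF norm_triangle_ineq]) simp
    also have "\<dots> \<le> s * 1 + s * 1"
      using that ab by (intro add_mono mult_mono) auto
    finally show ?thesis using s by (simp add: dist_norm add.assoc)
  qed
  have in0: "x + t *\<^sub>R a \<in> X" if "t \<in> {0..s}" for t
    using X[OF near[OF that, of 0]] s by simp
  have inX: "x + s *\<^sub>R b + t *\<^sub>R a \<in> X" if "t \<in> {0..s}" for t
    using X[OF near[OF that, of s]] s by (simp add: algebra_simps)
  \<comment> \<open>The increment of this function from 0 to \<open>s\<close> is the second
    difference of \<open>F\<close>. One mean value step along \<open>a\<close> yields a difference
    of \<open>G\<close>, and another along \<open>b\<close> yields \<open>H\<close>.\<close>
  let ?\<phi> = "\<lambda>t. F (x + s *\<^sub>R b + t *\<^sub>R a) - F (x + t *\<^sub>R a)"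
  have "\<exists>t\<in>closed_segment 0 s. ?\<phi> s - ?\<phi> 0 = (s - 0) * (G (x + s *\<^sub>R b + t *\<^sub>R a) - G (x + t *\<^sub>R a))"
    by (rule mvt_closed_segment, rule DERIV_diff; rule line_derivative_shift, rule F)
      (use s in0 inX in \<open>auto simp: closed_segment_eq_real_ivl\<close>)
  then obtain t where t: "t \<in> {0..s}"
    and t_eq: "?\<phi> s - ?\<phi> 0 = s * (G (x + s *\<^sub>R b + t *\<^sub>R a) - G (x + t *\<^sub>R a))"
    using s by (auto simp: closed_segment_eq_real_ivl)
  have "\<exists>r\<in>closed_segment 0 s. G (x + t *\<^sub>R a + s *\<^sub>R b) - G (x + t *\<^sub>R a + 0 *\<^sub>R b)
      = (s - 0) * H (x + t *\<^sub>R a + r *\<^sub>R b)"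
    by (rule mvt_closed_segment, rule line_derivative_shift, rule G, rule X, rule near[OF t])
      (use s in \<open>auto simp: closed_segment_eq_real_ivl\<close>)
  then obtain r where r: "r \<in> {0..s}"
    and r_eq: "G (x + t *\<^sub>R a + s *\<^sub>R b) - G (x + t *\<^sub>R a) = s * H (x + t *\<^sub>R a + r *\<^sub>R b)"
    using s by (auto simp: closed_segment_eq_real_ivl)
  have "?\<phi> s - ?\<phi> 0 = s * s * H (x + t *\<^sub>R a + r *\<^sub>R b)"
    using t_eq r_eq by (simp add: add.assoc add.commute[of "s *\<^sub>R b"])
  then show ?thesis
    using near[OF t r] by (intro exI[of _ "x + t *\<^sub>R a + r *\<^sub>R b"]) (simp add: algebra_simps)
qed

text \<open>The second difference of \<open>F\<close> is symmetric in \<open>a\<close> and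
  \<open>b\<close>. It equals \<open>s * s\<close> times a value of \<open>Hab\<close> and also of
  \<open>Hba\<close>, both at points near \<open>x\<close>, so continuity forces equality at
  \<open>x\<close>.\<close>

lemma mixed_derivatives_eq:
  fixes F :: "'a::real_normed_vector \<Rightarrow> real"
  assumes X: "open X" "x \<in> X"
    and Fa: "\<And>y. y \<in> X \<Longrightarrow> ((\<lambda>s. F (y + s *\<^sub>R a)) has_real_derivative Ga y) (at 0)"
    and Fb: "\<And>y. y \<in> X \<Longrightarrow> ((\<lambda>s. F (y + s *\<^sub>R b)) has_real_derivative Gb y) (at 0)"
    and Gab: "\<And>y. y \<in> X \<Longrightarrow> ((\<lambda>s. Ga (y + s *\<^sub>R b)) has_real_derivative Hab y) (at 0)"
    and Gba: "\<And>y. y \<in> X \<Longrightarrow> ((\<lambda>s. Gb (y + s *\<^sub>R a)) has_real_derivative Hba y) (at 0)"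
    and cont: "isCont Hab x" "isCont Hba x" and ab: "norm a \<le> 1" "norm b \<le> 1"
  shows "Hab x = Hba x"
proof (rule ccontr)
  assume "Hab x \<noteq> Hba x"
  \<comment> \<open>With half the gap as tolerance, a value of \<open>Hab\<close> near
    \<open>x\<close> cannot coincide with a value of \<open>Hba\<close> near
    \<open>x\<close>.\<close>
  define e where "e = \<bar>Hab x - Hba x\<bar> / 2"
  have e: "e > 0" using \<open>Hab x \<noteq> Hba x\<close> by (simp add: e_def)
  have ev: "\<forall>\<^sub>F y in nhds x. dist (H y) (H x) < e" if "isCont H x" for H :: "'a \<Rightarrow> real"
    using that e by (metis isCont_def tendsto_at_iff_tendsto_nhds tendstoD)
  have "\<forall>\<^sub>F y in nhds x. y \<in> X \<and> dist (Hab y) (Hab x) < e \<and> dist (Hba y) (Hba x) < e"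
    using X cont by (intro eventually_conj ev eventually_nhds_in_open)
  then obtain d where d: "d > 0"
    and near: "\<And>y. dist y x < d \<Longrightarrow> y \<in> X \<and> dist (Hab y) (Hab x) < e \<and> dist (Hba y) (Hba x) < e"
    unfolding eventually_nhds_metric by blast
  define s where "s = d / 3"
  have s: "0 < s" "2 * s < d" using d by (auto simp: s_def)
  have dX: "\<And>y. dist y x < d \<Longrightarrow> y \<in> X" using near by blast
  obtain z where z: "dist z x < d"
    "F (x + s *\<^sub>R a + s *\<^sub>R b) - F (x + s *\<^sub>R a) - F (x + s *\<^sub>R b) + F x = s * s * Hab z"
    using second_difference_mvt[OF dX Fa Gab ab s] by blast
  obtain w where w: "dist w x < d"
    "F (x + s *\<^sub>R b + s *\<^sub>R a) - F (x + s *\<^sub>R b) - F (x + s *\<^sub>R a) + F x = s * s * Hba w"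
    using second_difference_mvt[OF dX Fb Gba ab(2,1) s] by blast
  have swap: "x + s *\<^sub>R b + s *\<^sub>R a = x + s *\<^sub>R a + s *\<^sub>R b" by simp
  have "s * s * Hab z = s * s * Hba w" using z(2) w(2)[unfolded swap] by linarith
  then have "Hab z = Hba w" using s by simp
  then show False using near[OF z(1)] near[OF w(1)]
    unfolding dist_real_def e_def by argo
qed

section \<open>Second-order condition at a local minimum\<close>

lemma second_derivative_nonneg_at_local_min:
  fixes g :: "real \<Rightarrow> real"
  assumes d: "0 < d" and g: "\<And>t. \<bar>t\<bar> < d \<Longrightarrow> (g has_real_derivative g' t) (at t)"
    and min: "\<And>t. \<bar>t\<bar> < d \<Longrightarrow> g 0 \<le> g t" and g': "(g' has_real_derivative c) (at 0)"
  shows "0 \<le> c"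
proof (rule ccontr)
  assume "\<not> 0 \<le> c"
  \<comment> \<open>A negative \<open>c\<close> pushes \<open>g'\<close> below \<open>g' 0\<close>
    just to the right of 0; since \<open>g' 0 = 0\<close> at a minimum, the mean value theorem then
    makes \<open>g\<close> drop below \<open>g 0\<close>.\<close>
  then obtain r where r: "r > 0" "\<And>h. 0 < h \<Longrightarrow> h < r \<Longrightarrow> g' h < g' 0"
    using DERIV_neg_dec_right[OF g'] by auto
  have "g' 0 = 0" using DERIV_local_min[OF g[of 0] d] min d by simp
  define t where "t = min d r / 2"
  have t: "0 < t" "t < d" "t < r" using d r by (auto simp: t_def)
  have "\<exists>z\<in>{0<..<t}. g t - g 0 = g' z * (t - 0)"
    by (rule mvt_simple[OF t(1), of g "\<lambda>t h. g' t * h"])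
      (use g t in \<open>auto simp: has_field_derivative_def intro: has_derivative_at_withinI\<close>)
  then obtain z where z: "0 < z" "z < t" "g t - g 0 = g' z * t" by auto
  have "g' z < 0" using r(2)[of z] z t \<open>g' 0 = 0\<close> by simp
  then have "g t < g 0" using z t mult_neg_pos[of "g' z" t] by simp
  then show False using min[of t] t by simp
qed

text \<open>Along the line \<open>x + t *\<^sub>R v\<close> the function \<open>F\<close> has a
  local minimum at \<open>t = 0\<close>, and its second derivative there is the quadratic form of
  the Hessian at \<open>v\<close>.\<close>

lemma second_order_necessary_condition:
  fixes F :: "real ^ 'n::finite \<Rightarrow> real"
  assumes X: "open X" "x \<in> X"
    and F: "\<And>i y. y \<in> X \<Longrightarrow> ((\<lambda>s. F (y + s *\<^sub>R axis i 1)) has_real_derivative G i y) (at 0)"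
    and G: "\<And>i j y. y \<in> X \<Longrightarrow> ((\<lambda>s. G i (y + s *\<^sub>R axis j 1)) has_real_derivative H i j y) (at 0)"
    and cont: "\<And>i j y. y \<in> X \<Longrightarrow> isCont (H i j) y"
    and e: "0 < \<epsilon>" and min: "\<And>y. y \<in> X \<Longrightarrow> norm (y - x) < \<epsilon> \<Longrightarrow> F x \<le> F y"
  shows "pos_semidefinite (\<chi> i j. H i j x)"
  unfolding pos_semidefinite_def
proof (intro conjI allI)
  have "H i j x = H j i x" for i j
    by (rule mixed_derivatives_eq[OF X F F G G cont cont]) (simp_all add: X)
  then show "transpose (\<chi> i j. H i j x) = (\<chi> i j. H i j x)"
    by (simp add: transpose_def vec_eq_iff)
  fix v :: "real ^ 'n"
  \<comment> \<open>Continuity of \<open>H\<close> makes each \<open>G i\<close> differentiable,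
    hence continuous, which in turn makes \<open>F\<close> differentiable on
    \<open>X\<close>.\<close>
  have dG: "(G i has_derivative (\<lambda>v. \<Sum>j\<in>UNIV. v $ j * H i j y)) (at y)" if "y \<in> X" for i y
    by (rule has_derivative_continuous_partials[OF X(1) that G cont[OF that]])
  have dF: "(F has_derivative (\<lambda>v. \<Sum>i\<in>UNIV. v $ i * G i y)) (at y)" if "y \<in> X" for y
    by (rule has_derivative_continuous_partials[OF X(1) that F has_derivative_continuous[OF dG[OF that]]])
  have line: "((\<lambda>t. K (x + t *\<^sub>R v)) has_real_derivative (\<Sum>i\<in>UNIV. v $ i * D i)) (at t)"
    if K: "(K has_derivative (\<lambda>v. \<Sum>i\<in>UNIV. v $ i * D i)) (at (x + t *\<^sub>R v))"
    for K D and t :: real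
  proof -
    have "((\<lambda>t. x + t *\<^sub>R v) has_derivative (\<lambda>h. h *\<^sub>R v)) (at t)"
      by (auto intro!: derivative_eq_intros)
    from has_derivative_compose[OF this K] show ?thesis
      unfolding has_field_derivative_def
      by (rule has_derivative_eq_rhs) (auto simp: sum_distrib_right sum_distrib_left algebra_simps)
  qed
  obtain r where r: "r > 0" "ball x r \<subseteq> X" using X open_contains_ball by blast
  \<comment> \<open>The summand 1 avoids division by zero for \<open>v = 0\<close>; the bound keeps
    \<open>x + t *\<^sub>R v\<close> both in the ball inside \<open>X\<close> and within
    \<open>\<epsilon>\<close> of \<open>x\<close>.\<close>
  define d where "d = min r \<epsilon> / (norm v + 1)"
  have "norm v + 1 > 0" by (smt (verit) norm_ge_zero)
  then have d: "d > 0" using r e by (auto simp: d_def)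
  have small: "norm (t *\<^sub>R v) < min r \<epsilon>" if "\<bar>t\<bar> < d" for t
  proof -
    have "\<bar>t\<bar> * norm v \<le> \<bar>t\<bar> * (norm v + 1)" by (simp add: algebra_simps)
    also have "\<dots> < min r \<epsilon>"
      using that \<open>norm v + 1 > 0\<close> by (simp add: d_def pos_less_divide_eq)
    finally show ?thesis by simp
  qed
  have inX: "x + t *\<^sub>R v \<in> X" if "\<bar>t\<bar> < d" for t
    using small[OF that] r by (auto simp: dist_norm)
  have "0 \<le> (\<Sum>i\<in>UNIV. v $ i * (\<Sum>j\<in>UNIV. v $ j * H i j x))"
  proof (rule second_derivative_nonneg_at_local_min[OF d])
    show "((\<lambda>t. F (x + t *\<^sub>R v)) has_real_derivative (\<Sum>i\<in>UNIV. v $ i * G i (x + t *\<^sub>R v))) (at t)"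
      if "\<bar>t\<bar> < d" for t
      by (rule line[OF dF[OF inX[OF that]]])
    show "F (x + 0 *\<^sub>R v) \<le> F (x + t *\<^sub>R v)" if "\<bar>t\<bar> < d" for t
      using min[OF inX[OF that]] small[OF that] by simp
    have "((\<lambda>t. G i (x + t *\<^sub>R v)) has_real_derivative (\<Sum>j\<in>UNIV. v $ j * H i j x)) (at 0)" for i
      by (rule line) (simp add: dG X)
    then show "((\<lambda>t. \<Sum>i\<in>UNIV. v $ i * G i (x + t *\<^sub>R v)) has_real_derivative
        (\<Sum>i\<in>UNIV. v $ i * (\<Sum>j\<in>UNIV. v $ j * H i j x))) (at 0)"
      by (intro DERIV_sum DERIV_cmult)
  qed
  then show "0 \<le> v \<bullet> ((\<chi> i j. H i j x) *v v)"
    by (simp add: inner_vec_def matrix_vector_mult_def mult.commute)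
qed

section \<open>Linear functionals on fuzzy numbers\<close>

text \<open>A real supremum dominates its terms once the set is bounded above. All level sets lie in
  the one at level 0, whose endpoints supply the bound.\<close>

lemma endpoint_dist_le:
  assumes "\<alpha> \<in> {0..1}"
  shows "\<bar>lowr a \<alpha> - lowr b \<alpha>\<bar> \<le> dist a b" "\<bar>uppr a \<alpha> - uppr b \<alpha>\<bar> \<le> dist a b"
proof -
  let ?m = "\<lambda>\<alpha>. max \<bar>lowr a \<alpha> - lowr b \<alpha>\<bar> \<bar>uppr a \<alpha> - uppr b \<alpha>\<bar>"
  have "bdd_above (?m ` {0..1})"
  proof (rule bdd_aboveI2)
    fix \<alpha> :: real assume "\<alpha> \<in> {0..1}"
    then show "?m \<alpha> \<le> \<bar>lowr a 0\<bar> + \<bar>uppr a 0\<bar> + \<bar>lowr b 0\<bar> + \<bar>uppr b 0\<bar>"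
      using lowr_mono[of 0 \<alpha> a] lowr_mono[of 0 \<alpha> b] uppr_antimono[of 0 \<alpha> a] uppr_antimono[of 0 \<alpha> b]
        level_interval(2)[of \<alpha> a] level_interval(2)[of \<alpha> b] by auto
  qed
  from cSUP_upper[OF assms this] have "?m \<alpha> \<le> dist a b" unfolding dist_fuzzy_def .
  then show "\<bar>lowr a \<alpha> - lowr b \<alpha>\<bar> \<le> dist a b" "\<bar>uppr a \<alpha> - uppr b \<alpha>\<bar> \<le> dist a b" by auto
qed

text \<open>Common interface of the endpoint sum at a fixed level and of the integral behind the
  order. Homogeneity for negative \<open>s\<close> as well rules out a single endpoint as an
  instance.\<close>

locale fuzzy_functional =
  fixes \<phi> :: "fuzzy \<Rightarrow> real" and C :: real
  assumes add: "\<phi> (a \<oplus> b) = \<phi> a + \<phi> b"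
    and scale: "\<phi> (s \<odot> a) = s * \<phi> a"
    and lipschitz: "\<bar>\<phi> a - \<phi> b\<bar> \<le> C * dist a b"
begin

text \<open>Both alternatives in \<open>is_gH_diff\<close> give the same value, because
  \<open>\<phi>\<close> sends \<open>(- 1) \<odot> c\<close> to \<open>- \<phi> c\<close>.\<close>

lemma gH_diff:
  assumes "gH_diff_exists a b" shows "\<phi> (a \<ominus>\<^sub>g\<^sub>H b) = \<phi> a - \<phi> b"
proof -
  obtain c where c: "is_gH_diff a b c" using assms by (auto simp: gH_diff_exists_def)
  then have "\<phi> c = \<phi> a - \<phi> b"
    unfolding is_gH_diff_def
  proof
    assume "a = b \<oplus> c"
    then show ?thesis by (simp add: add)
  next
    assume "b = a \<oplus> ((- 1) \<odot> c)"
    then have "\<phi> b = \<phi> a - \<phi> c" using add[of a "(- 1) \<odot> c"] scale[of "- 1" c] by simp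
    then show ?thesis by simp
  qed
  then show ?thesis using gH_diff_eq[OF c] by simp
qed

lemma tendsto: "((\<lambda>x. \<phi> (g x)) \<longlongrightarrow> \<phi> c) L" if "(g \<longlongrightarrow> c) L"
proof -
  have "((\<lambda>x. dist (g x) c) \<longlongrightarrow> 0) L" using that by (simp add: tendsto_dist_iff[symmetric])
  then have "((\<lambda>x. C * dist (g x) c) \<longlongrightarrow> 0) L" by (rule tendsto_mult_right_zero)
  then have "((\<lambda>x. \<phi> (g x) - \<phi> c) \<longlongrightarrow> 0) L"
    by (rule Lim_null_comparison[rotated]) (simp add: lipschitz)
  then show ?thesis by (simp add: Lim_null[symmetric])
qed

text \<open>For all small nonzero \<open>h\<close> the gH-difference exists, and
  \<open>\<phi>\<close> maps the gH-difference quotient to the ordinary difference quotient;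
  continuity of \<open>\<phi>\<close> carries the limit over.\<close>

lemma has_derivative: "((\<lambda>t. \<phi> (g t)) has_real_derivative \<phi> c) (at x)" if "has_gH_derivative g c x"
proof -
  have "((\<lambda>h. \<phi> ((1 / h) \<odot> (g (x + h) \<ominus>\<^sub>g\<^sub>H g x))) \<longlongrightarrow> \<phi> c) (at 0)"
    using that by (intro tendsto) (simp add: has_gH_derivative_def)
  moreover have "\<forall>\<^sub>F h in at 0. \<phi> ((1 / h) \<odot> (g (x + h) \<ominus>\<^sub>g\<^sub>H g x)) = (\<phi> (g (x + h)) - \<phi> (g x)) / h"
    using that unfolding has_gH_derivative_def
    by (auto elim!: eventually_mono simp: scale gH_diff)
  ultimately have "((\<lambda>h. (\<phi> (g (x + h)) - \<phi> (g x)) / h) \<longlongrightarrow> \<phi> c) (at 0)"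
    by (rule Lim_transform_eventually)
  then show ?thesis by (simp add: DERIV_def)
qed

lemma has_partial:
  assumes "gH_partial_exists i f x"
  shows "(section_at i (\<lambda>y. \<phi> (f y)) x has_real_derivative \<phi> (gH_partial i f x)) (at (x $ i))"
proof -
  obtain c where c: "has_gH_partial i f c x" using assms by (auto simp: gH_partial_exists_def)
  have "section_at i (\<lambda>y. \<phi> (f y)) x = (\<lambda>t. \<phi> (section_at i f x t))"
    by (simp add: section_at_def fun_eq_iff)
  then show ?thesis
    using has_derivative[of "section_at i f x" c "x $ i"] c gH_partial_eq[OF c]
    by (simp add: has_gH_partial_def)
qed

end

text \<open>A negative scalar swaps the two endpoints, which leaves their sum homogeneous. The
  constant 2 counts the endpoints.\<close>

lemma fuzzy_functional_endpoint_sum: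
  assumes "\<alpha> \<in> {0..1}" shows "fuzzy_functional (\<lambda>a. lowr a \<alpha> + uppr a \<alpha>) 2"
proof
  show "\<bar>lowr a \<alpha> + uppr a \<alpha> - (lowr b \<alpha> + uppr b \<alpha>)\<bar> \<le> 2 * dist a b" for a b
    using endpoint_dist_le[OF assms, of a b] by linarith
qed (auto simp: endpoints_add[OF assms] endpoints_scale[OF assms] algebra_simps)

text \<open>Subtracting the values at level 0 makes each endpoint term a product of nonnegative
  increasing functions, hence monotone and integrable. The correction is continuous in
  \<open>\<alpha>\<close>.\<close>

lemma endpoint_sum_integrable: "(\<lambda>\<alpha>. \<alpha> * (lowr a \<alpha> + uppr a \<alpha>)) integrable_on {0..1}"
proof -
  have "(\<lambda>\<alpha>. \<alpha> * (lowr a \<alpha> - lowr a 0)) integrable_on {0..1}"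
    by (rule integrable_on_mono_on, rule mono_onI, rule mult_mono)
      (auto intro: lowr_mono)
  moreover have "(\<lambda>\<alpha>. \<alpha> * (uppr a 0 - uppr a \<alpha>)) integrable_on {0..1}"
    by (rule integrable_on_mono_on, rule mono_onI, rule mult_mono)
      (auto intro: uppr_antimono)
  moreover have "(\<lambda>\<alpha>. \<alpha> * (lowr a 0 + uppr a 0)) integrable_on {0..1::real}"
    by (intro integrable_continuous_real continuous_intros)
  ultimately have "(\<lambda>\<alpha>. \<alpha> * (lowr a \<alpha> - lowr a 0) - \<alpha> * (uppr a 0 - uppr a \<alpha>)
      + \<alpha> * (lowr a 0 + uppr a 0)) integrable_on {0..1}"
    by (intro integrable_add integrable_diff)
  then show ?thesis by (simp add: algebra_simps)
qed

text \<open>The quantity that \<open>\<preceq>\<close> compares.\<close>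

definition ranking :: "fuzzy \<Rightarrow> real" where
  "ranking a = integral {0..1} (\<lambda>\<alpha>. \<alpha> * (lowr a \<alpha> + uppr a \<alpha>))"

lemma fuzzy_functional_ranking: "fuzzy_functional ranking 2"
proof
  fix a b :: fuzzy and s :: real
  have "ranking (a \<oplus> b) = integral {0..1} (\<lambda>\<alpha>. \<alpha> * (lowr a \<alpha> + uppr a \<alpha>) + \<alpha> * (lowr b \<alpha> + uppr b \<alpha>))"
    unfolding ranking_def by (rule integral_cong) (simp add: endpoints_add algebra_simps)
  then show "ranking (a \<oplus> b) = ranking a + ranking b"
    by (simp add: ranking_def integral_add endpoint_sum_integrable)
  have "ranking (s \<odot> a) = integral {0..1} (\<lambda>\<alpha>. s * (\<alpha> * (lowr a \<alpha> + uppr a \<alpha>)))"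
    unfolding ranking_def by (rule integral_cong) (simp add: endpoints_scale algebra_simps)
  then show "ranking (s \<odot> a) = s * ranking a"
    by (simp add: ranking_def)
  \<comment> \<open>The weight is at most 1 and the interval has length 1, so the constant 2 of the
    endpoint sum survives integration.\<close>
  have "norm (integral {0..1} (\<lambda>\<alpha>. \<alpha> * (lowr a \<alpha> + uppr a \<alpha>) - \<alpha> * (lowr b \<alpha> + uppr b \<alpha>)))
      \<le> integral {0..1::real} (\<lambda>\<alpha>. 2 * dist a b)"
  proof (rule integral_norm_bound_integral)
    fix \<alpha> :: real assume \<alpha>: "\<alpha> \<in> {0..1}"
    interpret fuzzy_functional "\<lambda>a. lowr a \<alpha> + uppr a \<alpha>" 2
      using \<alpha> by (rule fuzzy_functional_endpoint_sum)
    have "\<bar>\<alpha>\<bar> * \<bar>lowr a \<alpha> + uppr a \<alpha> - (lowr b \<alpha> + uppr b \<alpha>)\<bar> \<le> 1 * (2 * dist a b)"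
      using \<alpha> by (intro mult_mono lipschitz) auto
    then show "norm (\<alpha> * (lowr a \<alpha> + uppr a \<alpha>) - \<alpha> * (lowr b \<alpha> + uppr b \<alpha>)) \<le> 2 * dist a b"
      by (simp add: abs_mult[symmetric] right_diff_distrib)
  qed (auto intro!: integrable_diff endpoint_sum_integrable)
  then show "\<bar>ranking a - ranking b\<bar> \<le> 2 * dist a b"
    by (simp add: ranking_def integral_diff endpoint_sum_integrable)
qed

section \<open>Hessians of linear functionals of fuzzy-valued functions\<close>

text \<open>The distinguished partial exists at \<open>x\<close> by definition; the others exist
  near \<open>x\<close>, and a neighborhood contains its centre.\<close>

lemma gH_differentiable_at_imp_partial_exists:
  "gH_differentiable_at f x \<Longrightarrow> gH_partial_exists i f x"
  unfolding gH_differentiable_at_def by (metis eventually_nhds_x_imp_x)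

lemma twice_continuously_gH_differentiable_partials:
  assumes "twice_continuously_gH_differentiable_on f X" "x \<in> X"
  shows "gH_partial_exists i f x" "gH_partial_exists j (gH_partial i f) x"
  using assms gH_differentiable_at_imp_partial_exists
  unfolding twice_continuously_gH_differentiable_on_def twice_gH_differentiable_at_def
    gH_differentiable_on_def by blast+

text \<open>\<open>has_partial\<close> is applied twice, first to \<open>f\<close> and then to its
  gH-partials.\<close>

lemma (in fuzzy_functional) hessian:
  assumes X: "open X" "x \<in> X" and f: "twice_continuously_gH_differentiable_on f X"
  shows "hessian_exists (\<lambda>y. \<phi> (f y)) x"
    and "hessian (\<lambda>y. \<phi> (f y)) x $ i $ j = \<phi> (gH_partial2 i j f x)"
proof -
  note P = twice_continuously_gH_differentiable_partials[OF f]
  have eq: "partial i (\<lambda>y. \<phi> (f y)) y = \<phi> (gH_partial i f y)" if "y \<in> X" for i y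
    unfolding partial_def by (rule DERIV_imp_deriv[OF has_partial[OF P(1)[OF that]]])
  have d2: "(section_at j (partial i (\<lambda>y. \<phi> (f y))) x has_real_derivative \<phi> (gH_partial2 i j f x))
      (at (x $ j))" for i j
  proof -
    \<comment> \<open>\<open>eq\<close> holds on \<open>X\<close>, so the derivative is transferred
      on the open set of parameters whose points on the line lie in \<open>X\<close>.\<close>
    have "continuous_on UNIV (\<lambda>s::real. x + s *\<^sub>R axis j 1)" by (intro continuous_intros)
    then have op: "open ((\<lambda>s::real. x + s *\<^sub>R axis j 1) -` X)"
      using X by (simp add: continuous_on_open_vimage)
    have "((\<lambda>s. \<phi> (gH_partial i f (x + s *\<^sub>R axis j 1))) has_real_derivative \<phi> (gH_partial2 i j f x)) (at 0)"
      using has_partial[OF P(2)[OF X(2)], of j i] unfolding section_at_has_derivative_iff gH_partial2_def .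
    then show ?thesis unfolding section_at_has_derivative_iff
      by (rule has_field_derivative_transform_within_open[OF _ op]) (use X eq in auto)
  qed
  show "hessian (\<lambda>y. \<phi> (f y)) x $ i $ j = \<phi> (gH_partial2 i j f x)"
    unfolding hessian_def using DERIV_imp_deriv[OF d2] by (simp add: partial_def[of j])
  have "\<forall>\<^sub>F y in nhds x. partial_exists i (\<lambda>y. \<phi> (f y)) y" for i
    using eventually_nhds_in_open[OF X]
    by eventually_elim (use has_partial[OF P(1)] in \<open>auto simp: partial_exists_def real_differentiable_def\<close>)
  moreover have "partial_exists j (partial i (\<lambda>y. \<phi> (f y))) x" for i j
    using d2 by (auto simp: partial_exists_def real_differentiable_def)
  ultimately show "hessian_exists (\<lambda>y. \<phi> (f y)) x" by (simp add: hessian_exists_def)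
qed

text \<open>\<open>deriv\<close> and \<open>integral\<close> are total functions; the conjuncts on
  existence and integrability ensure that the matrix is built from genuine derivatives and
  integrals.\<close>

theorem theorem3p2:
  fixes X :: "(real ^ 'n::finite) set"
    and f :: "real ^ 'n \<Rightarrow> fuzzy"
    and xs :: "real ^ 'n"
  assumes "open X"
    and "twice_continuously_gH_differentiable_on f X"
    and "local_minimizer f X xs"
  shows "(\<forall>\<alpha>\<in>{0..1}. hessian_exists (\<lambda>x. lowr (f x) \<alpha> + uppr (f x) \<alpha>) xs) \<and>
         (\<forall>i j. (\<lambda>\<alpha>. \<alpha> * hessian (\<lambda>x. lowr (f x) \<alpha> + uppr (f x) \<alpha>) xs $ i $ j)
                  integrable_on {0..1}) \<and>
         pos_semidefinite
           (\<chi> i j. integral {0..1}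
              (\<lambda>\<alpha>. \<alpha> * hessian (\<lambda>x. lowr (f x) \<alpha> + uppr (f x) \<alpha>) xs $ i $ j))"
proof (intro conjI ballI allI)
  have xs: "xs \<in> X" using assms(3) by (simp add: local_minimizer_def)
  note H = fuzzy_functional.hessian[OF fuzzy_functional_endpoint_sum assms(1) xs assms(2)]
  note P = twice_continuously_gH_differentiable_partials[OF assms(2)]
  show "hessian_exists (\<lambda>x. lowr (f x) \<alpha> + uppr (f x) \<alpha>) xs" if "\<alpha> \<in> {0..1}" for \<alpha>
    by (rule H(1)[OF that])
  \<comment> \<open>The second gH-partial is one fuzzy number for all levels, so the integrand is
    its weighted endpoint sum.\<close>
  have eq: "\<alpha> * hessian (\<lambda>x. lowr (f x) \<alpha> + uppr (f x) \<alpha>) xs $ i $ j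
      = \<alpha> * (lowr (gH_partial2 i j f xs) \<alpha> + uppr (gH_partial2 i j f xs) \<alpha>)" if "\<alpha> \<in> {0..1}" for \<alpha> i j
    by (simp only: H(2)[OF that])
  show "(\<lambda>\<alpha>. \<alpha> * hessian (\<lambda>x. lowr (f x) \<alpha> + uppr (f x) \<alpha>) xs $ i $ j) integrable_on {0..1}" for i j
    by (rule integrable_eq[OF endpoint_sum_integrable]) (rule eq[symmetric])
  \<comment> \<open>The integrated matrix thus has the entries of the Hessian of
    \<open>ranking\<close> composed with \<open>f\<close>, with no interchange of derivative and
    integral.\<close>
  have int: "integral {0..1} (\<lambda>\<alpha>. \<alpha> * hessian (\<lambda>x. lowr (f x) \<alpha> + uppr (f x) \<alpha>) xs $ i $ j)
      = ranking (gH_partial2 i j f xs)" for i j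
    unfolding ranking_def by (rule integral_cong) (rule eq)
  interpret fuzzy_functional ranking 2 by (rule fuzzy_functional_ranking)
  obtain \<epsilon> where \<epsilon>: "\<epsilon> > 0" "\<And>x. x \<in> X \<Longrightarrow> norm (x - xs) < \<epsilon> \<Longrightarrow> f xs \<preceq> f x"
    using assms(3) by (auto simp: local_minimizer_def)
  have "pos_semidefinite (\<chi> i j. ranking (gH_partial2 i j f xs))"
  proof (rule second_order_necessary_condition[OF assms(1) xs _ _ _ \<epsilon>(1)])
    fix i j y assume y: "y \<in> X"
    show "((\<lambda>s. ranking (f (y + s *\<^sub>R axis i 1))) has_real_derivative ranking (gH_partial i f y)) (at 0)"
      using has_partial[OF P(1)[OF y]] unfolding section_at_has_derivative_iff .
    show "((\<lambda>s. ranking (gH_partial i f (y + s *\<^sub>R axis j 1))) has_real_derivative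
        ranking (gH_partial2 i j f y)) (at 0)"
      using has_partial[OF P(2)[OF y]] unfolding section_at_has_derivative_iff gH_partial2_def .
    have "isCont (gH_partial2 i j f) y"
      using assms y by (auto simp: twice_continuously_gH_differentiable_on_def continuous_on_eq_continuous_at)
    then show "isCont (\<lambda>y. ranking (gH_partial2 i j f y)) y"
      unfolding isCont_def by (rule tendsto)
  next
    fix y assume "y \<in> X" "norm (y - xs) < \<epsilon>"
    then show "ranking (f xs) \<le> ranking (f y)"
      using \<epsilon>(2) by (simp add: fuzzy_le_def ranking_def)
  qed
  then show "pos_semidefinite
      (\<chi> i j. integral {0..1} (\<lambda>\<alpha>. \<alpha> * hessian (\<lambda>x. lowr (f x) \<alpha> + uppr (f x) \<alpha>) xs $ i $ j))"
    by (simp add: int)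
qed

end
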